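(* There is an absolute constant $C$ such that for all $\epsilon,\alpha\in(0,1)$ with $\alpha+\epsilon<1$ and every integer $n\ge 2$, there exists a nonadaptive $\alpha$-erasure-resilient $\epsilon$-tester for monotonicity of real-valued arrays of length $n$ that makes at most $C\left(\frac{\log n}{\epsilon^2}+\frac{1}{\epsilon^3}\right)$ queries.
   Context: An array $A$ of length $n$ is $\alpha$-erased if at most an $\alpha$ fraction of its entries are the special symbol $\perp$ (erased), the remaining entries being real numbers. Erasures are made adversarially before the tester makes its queries, and the tester does not know their locations; the oracle, on query $i\in[n]$, returns $\perp$ if entry $i$ is erased and $A[i]$ otherwise. A completion of $A$ is an array obtained by assigning real values to all erased entries. A (fully nonerased) array is monotone if $A[u]\le A[v]$ for all $u<v$. Given $\epsilon,\alpha\in(0,1)$, an $\alpha$-erasure-resilient $\epsilon$-tester for monotonicity is a randomized algorithm that, given oracle access to an $\alpha$-erased array $A$ of length $n$, accepts with probability at least $2/3$ if $A$ has a monotone completion, and rejects with probability at least $2/3$ if every completion of $A$ has Hamming distance at least $\epsilon n$ from the set of monotone arrays. It is nonadaptive if its queries do not depend on the answers to its previous queries. *)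

theory Defs
  imports "HOL-Probability.Probability"
begin

text \<open>Arrays are lists indexed from 0, and \<open>None\<close> is the erasure symbol. Monotonicity of a
  nonerased array is the library predicate \<^const>\<open>sorted\<close>.\<close>

definition erased_array :: "real \<Rightarrow> real option list \<Rightarrow> bool" where
  "erased_array \<alpha> A \<longleftrightarrow> real (card {i. i < length A \<and> A ! i = None}) \<le> \<alpha> * real (length A)"

definition completion :: "real option list \<Rightarrow> real list \<Rightarrow> bool" where
  "completion A B \<longleftrightarrow>
     length B = length A \<and> (\<forall>i<length A. A ! i \<noteq> None \<longrightarrow> A ! i = Some (B ! i))"

text \<open>Meant for lists of equal length.\<close>

definition hamming_dist :: "real list \<Rightarrow> real list \<Rightarrow> nat" where
  "hamming_dist B M = card {i. i < length B \<and> B ! i \<noteq> M ! i}"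

text \<open>The infimum ranges over a nonempty set of natural numbers (constant arrays are monotone),
  so it is attained.\<close>

definition dist_to_monotone :: "real list \<Rightarrow> nat" where
  "dist_to_monotone B = (INF M \<in> {M. length M = length B \<and> sorted M}. hamming_dist B M)"

text \<open>A deterministic query algorithm is a decision tree; a randomized one is a probability
  distribution over decision trees, that is, the coins are tossed in advance.\<close>

datatype query_algorithm =
  Decide bool
| Query nat "real option \<Rightarrow> query_algorithm"

primrec accepts :: "query_algorithm \<Rightarrow> real option list \<Rightarrow> bool" where
  "accepts (Decide b) A = b"
| "accepts (Query i k) A = accepts (k (A ! i)) A"

primrec queries :: "query_algorithm \<Rightarrow> real option list \<Rightarrow> nat list" where
  "queries (Decide b) A = []"
| "queries (Query i k) A = i # queries (k (A ! i)) A"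

type_synonym randomized_algorithm = "query_algorithm pmf"

text \<open>The oracle only answers queries to positions of the array; this also keeps the junk values
  of \<^term>\<open>A ! i\<close> for \<^term>\<open>i \<ge> length A\<close> out of play.\<close>

definition legal_queries :: "nat \<Rightarrow> randomized_algorithm \<Rightarrow> bool" where
  "legal_queries n T \<longleftrightarrow>
     (\<forall>t\<in>set_pmf T. \<forall>A. length A = n \<longrightarrow> set (queries t A) \<subseteq> {..<n})"

definition erasure_resilient_tester ::
    "real \<Rightarrow> real \<Rightarrow> nat \<Rightarrow> randomized_algorithm \<Rightarrow> bool" where
  "erasure_resilient_tester \<alpha> \<epsilon> n T \<longleftrightarrow>
     legal_queries n T \<and>
     (\<forall>A. length A = n \<and> erased_array \<alpha> A \<longrightarrow>
        ((\<exists>B. completion A B \<and> sorted B) \<longrightarrow>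
           measure_pmf.prob T {t. accepts t A} \<ge> 2 / 3) \<and>
        ((\<forall>B. completion A B \<longrightarrow> real (dist_to_monotone B) \<ge> \<epsilon> * real n) \<longrightarrow>
           measure_pmf.prob T {t. \<not> accepts t A} \<ge> 2 / 3))"

text \<open>Once the coins are fixed, the sequence of queries is the same whatever the oracle answers.\<close>

definition nonadaptive :: "nat \<Rightarrow> randomized_algorithm \<Rightarrow> bool" where
  "nonadaptive n T \<longleftrightarrow>
     (\<forall>t\<in>set_pmf T. \<forall>A A'. length A = n \<and> length A' = n \<longrightarrow> queries t A = queries t A')"

definition makes_at_most_queries :: "nat \<Rightarrow> randomized_algorithm \<Rightarrow> real \<Rightarrow> bool" where
  "makes_at_most_queries n T q \<longleftrightarrow>
     (\<forall>t\<in>set_pmf T. \<forall>A. length A = n \<longrightarrow> real (length (queries t A)) \<le> q)"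

end

theory Submission
  imports Defs
begin

text \<open>The tester looks for violations: unerased positions \<open>i < j\<close> with \<open>A[i] > A[j]\<close>.
  Call an unerased position sparse if some interval starting there has a fraction less than
  \<open>\<epsilon>/2\<close> of unerased entries; there are at most \<open>\<epsilon> n / 2\<close> sparse positions.  If \<open>(i, j)\<close> is a
  violation and \<open>i\<close> is not sparse, then \<open>[i, j]\<close> has many unerased entries, and each of them
  violates with \<open>i\<close> or with \<open>j\<close>; so one of \<open>i, j\<close> is exposed, that is, it violates with a
  fraction of at least \<open>\<epsilon>/4\<close> of the entries of an interval to one side of it.  The sparse and
  the exposed positions cover all violations, so if the array is far from monotone then at least
  \<open>\<epsilon> n / 2\<close> positions are exposed.  A trial that picks a random position, a random dyadic scale
  and a random offset at that scale therefore finds a violation with probability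
  \<open>\<Omega>(\<epsilon>\<^sup>2 / log n)\<close>, and \<open>O(log n / \<epsilon>\<^sup>2)\<close> independent trials suffice.\<close>

section \<open>Violations and the distance of a completion from monotonicity\<close>

definition unerased :: "real option list \<Rightarrow> nat set" where
  "unerased A = {i. i < length A \<and> A ! i \<noteq> None}"

definition violation :: "real option list \<Rightarrow> nat \<Rightarrow> nat \<Rightarrow> bool" where
  "violation A i j \<longleftrightarrow>
     i < j \<and> j < length A \<and> (\<exists>a b. A ! i = Some a \<and> A ! j = Some b \<and> b < a)"

lemma finite_unerased [simp]: "finite (unerased A)"
  by (simp add: unerased_def)

lemma violation_unerased:
  "violation A i j \<Longrightarrow> i \<in> unerased A" "violation A i j \<Longrightarrow> j \<in> unerased A"
  by (auto simp: violation_def unerased_def)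

lemma finite_violation [simp]:
  "finite {k. violation A i k \<and> P k}" "finite {k. violation A k i \<and> P k}"
  by (rule finite_subset[of _ "unerased A"]; auto dest: violation_unerased)+

lemma sorted_completion_no_violation:
  assumes "completion A B" "sorted B"
  shows "\<not> violation A i j"
proof
  assume v: "violation A i j"
  then have "i < j" "j < length A" by (auto simp: violation_def)
  with assms have "B ! i \<le> B ! j" by (auto simp: completion_def intro: sorted_nth_mono)
  moreover have "A ! i = Some (B ! i)" "A ! j = Some (B ! j)"
    using v assms(1) by (auto simp: violation_def completion_def)
  ultimately show False using v by (auto simp: violation_def)
qed

text \<open>Outside \<open>U\<close> the unerased values are nondecreasing, so their running maximum
  \<open>f\<close> is a monotone function through all of them. Filling the erased positions from
  \<open>f\<close> confines every disagreement with \<open>f\<close> to \<open>U\<close>.\<close>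

lemma completion_near_monotone:
  assumes cov: "\<And>i j. violation A i j \<Longrightarrow> i \<in> U \<or> j \<in> U" and fin: "finite U"
  shows "\<exists>B. completion A B \<and> dist_to_monotone B \<le> card U"
proof -
  define G where "G = unerased A - U"
  define v where "v i = the (A ! i)" for i
  \<comment> \<open>A lower bound for all values on \<open>G\<close>: it keeps the set under
    \<open>Max\<close> nonempty to the left of \<open>G\<close> without affecting the maximum on
    \<open>G\<close>.\<close>
  define c where "c = - (\<Sum>j\<in>G. \<bar>v j\<bar>)"
  have finG: "finite G" by (simp add: G_def)
  have c: "c \<le> v j" if "j \<in> G" for j
  proof -
    have "\<bar>v j\<bar> \<le> (\<Sum>j\<in>G. \<bar>v j\<bar>)"
      using finG that by (intro member_le_sum) auto
    then show ?thesis by (simp add: c_def)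
  qed
  define f where "f i = Max (insert c (v ` {j \<in> G. j \<le> i}))" for i
  have f_mono: "f i \<le> f j" if "i \<le> j" for i j
    unfolding f_def using finG that by (intro Max_mono) auto
  have f_eq: "f i = v i" if "i \<in> G" for i
    unfolding f_def
  proof (rule Max_eqI)
    show "finite (insert c (v ` {j \<in> G. j \<le> i}))" using finG by simp
    show "v i \<in> insert c (v ` {j \<in> G. j \<le> i})" using that by simp
    fix y assume "y \<in> insert c (v ` {j \<in> G. j \<le> i})"
    then consider "y = c" | j where "j \<in> G" "j \<le> i" "y = v j" by auto
    then show "y \<le> v i"
    proof cases
      case 2
      have "\<not> violation A j i" using cov[of j i] 2 that by (auto simp: G_def)
      moreover have "j = i \<or> j < i" using 2 by auto
      ultimately show ?thesis
        using 2 that by (auto simp: violation_def G_def unerased_def v_def)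
    qed (use c that in simp)
  qed
  define M where "M = map f [0..<length A]"
  define B where "B = map (\<lambda>i. if A ! i = None then f i else v i) [0..<length A]"
  have "completion A B" by (auto simp: completion_def B_def v_def)
  moreover have "sorted M"
    unfolding M_def sorted_iff_nth_mono by (auto intro: f_mono)
  then have "dist_to_monotone B \<le> hamming_dist B M"
    unfolding dist_to_monotone_def by (intro cINF_lower) (auto simp: M_def B_def)
  moreover have "hamming_dist B M \<le> card U"
    unfolding hamming_dist_def
  proof (rule card_mono[OF fin], safe)
    fix i assume i: "i < length B" "B ! i \<noteq> M ! i"
    show "i \<in> U"
    proof (rule ccontr)
      assume "i \<notin> U"
      have iA: "i < length A" using i(1) by (simp add: B_def)
      with \<open>i \<notin> U\<close> have "A ! i \<noteq> None \<Longrightarrow> i \<in> G" by (auto simp: G_def unerased_def)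
      then have "B ! i = f i" using iA f_eq by (auto simp: B_def)
      with i(2) iA show False by (simp add: M_def)
    qed
  qed
  ultimately show ?thesis by (meson le_trans)
qed

section \<open>Sparse and exposed positions\<close>

definition sparse_points :: "real \<Rightarrow> nat \<Rightarrow> nat set \<Rightarrow> nat set" where
  "sparse_points \<delta> n N =
     {x \<in> N. \<exists>l>0. x + l \<le> n \<and> real (card (N \<inter> {x..<x + l})) < \<delta> * real l}"

text \<open>The greedy left-to-right choice of sparse intervals gives disjoint intervals covering
  all the sparse points.\<close>

lemma card_sparse_points_from:
  assumes "finite N" "0 \<le> \<delta>" "a \<le> n"
  shows "real (card (sparse_points \<delta> n N \<inter> {a..<n})) \<le> \<delta> * real (n - a)"
  using assms(3)
proof (induction "n - a" arbitrary: a rule: less_induct)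
  case less
  let ?S = "sparse_points \<delta> n N"
  have finS: "finite (?S \<inter> X)" for X
    using assms(1) by (auto simp: sparse_points_def intro: finite_subset[of _ N])
  \<comment> \<open>It suffices to peel off one block starting at \<open>a\<close> in which sparse
    points have density at most \<open>\<delta>\<close>. The block is the single position
    \<open>a\<close> if \<open>a\<close> is not sparse, and otherwise a sparse interval that starts
    there.\<close>
  have step: ?case
    if l: "l > 0" "a + l \<le> n" "real (card (?S \<inter> {a..<a + l})) \<le> \<delta> * real l" for l
  proof -
    have "?S \<inter> {a..<n} = (?S \<inter> {a..<a + l}) \<union> (?S \<inter> {a + l..<n})" using l by auto
    then have "card (?S \<inter> {a..<n}) \<le> card (?S \<inter> {a..<a + l}) + card (?S \<inter> {a + l..<n})"
      by (simp add: card_Un_le)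
    moreover have "real (card (?S \<inter> {a + l..<n})) \<le> \<delta> * real (n - (a + l))"
      using l by (intro less) auto
    moreover have "\<delta> * real (n - a) = \<delta> * real l + \<delta> * real (n - (a + l))"
      using l by (simp add: of_nat_diff algebra_simps)
    ultimately show ?thesis using l(3) by linarith
  qed
  consider "a = n" | "a < n" "a \<notin> ?S" | "a \<in> ?S" using less.prems by linarith
  then show ?case
  proof cases
    case 2
    then have "?S \<inter> {a..<a + 1} = {}" by auto
    with 2 assms(2) show ?thesis by (intro step[of 1]) auto
  next
    case 3
    then obtain l where l: "l > 0" "a + l \<le> n" "real (card (N \<inter> {a..<a + l})) < \<delta> * real l"
      by (auto simp: sparse_points_def)
    have "card (?S \<inter> {a..<a + l}) \<le> card (N \<inter> {a..<a + l})"
      using assms(1) by (intro card_mono) (auto simp: sparse_points_def)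
    with l show ?thesis by (intro step[of l]) auto
  qed auto
qed

lemma card_sparse_points:
  assumes "N \<subseteq> {..<n}" "0 \<le> \<delta>"
  shows "real (card (sparse_points \<delta> n N)) \<le> \<delta> * real n"
proof -
  have "sparse_points \<delta> n N \<inter> {0..<n} = sparse_points \<delta> n N"
    using assms(1) by (auto simp: sparse_points_def)
  with card_sparse_points_from[of N \<delta> 0 n] assms show ?thesis
    by (auto simp: finite_subset)
qed

text \<open>The two disjuncts look to the right and to the left of \<open>x\<close>;
  \<open>x < y + l\<close> avoids truncated subtraction. The factor 2 reflects that the entries of a
  dense interval are shared between the two ends of a violation.\<close>

definition exposed :: "real \<Rightarrow> real option list \<Rightarrow> nat set" where
  "exposed \<delta> A = {x. x < length A \<and> (\<exists>l. 0 < l \<and> l \<le> length A \<and>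
     (\<delta> * real l \<le> 2 * real (card {y. violation A x y \<and> y < x + l}) \<or>
      \<delta> * real l \<le> 2 * real (card {y. violation A y x \<and> x < y + l})))}"

lemma finite_exposed [simp]: "finite (exposed \<delta> A)"
  by (rule finite_subset[of _ "{..<length A}"]) (auto simp: exposed_def)

text \<open>Every unerased entry between the two ends of a violation violates with one of them.\<close>

lemma violation_cover:
  assumes v: "violation A i j"
  shows "i \<in> sparse_points \<delta> (length A) (unerased A) \<or> i \<in> exposed \<delta> A \<or> j \<in> exposed \<delta> A"
proof (cases "i \<in> sparse_points \<delta> (length A) (unerased A)")
  case False
  \<comment> \<open>The interval contains both ends, hence the \<open>+ 1\<close>.\<close>
  define l where "l = j - i + 1"
  have ij: "i < j" "j < length A" using v by (auto simp: violation_def)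
  let ?R = "{y. violation A i y \<and> y < i + l}" and ?L = "{y. violation A y j \<and> j < y + l}"
  have l: "0 < l" "i + l \<le> length A" using ij by (auto simp: l_def)
  then have "\<delta> * real l \<le> real (card (unerased A \<inter> {i..<i + l}))"
    using False violation_unerased(1)[OF v] by (auto simp: sparse_points_def not_less)
  also have "unerased A \<inter> {i..<i + l} \<subseteq> ?R \<union> ?L"
  proof
    fix y assume y: "y \<in> unerased A \<inter> {i..<i + l}"
    then have "i \<le> y" "y \<le> j" "y < i + l" "j < y + l" using ij by (auto simp: l_def)
    \<comment> \<open>If \<open>A[y] < A[i]\<close>, then \<open>y\<close> violates with
      \<open>i\<close>; otherwise \<open>A[y] \<ge> A[i] > A[j]\<close>, and \<open>y\<close>
      violates with \<open>j\<close>.\<close>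
    moreover have "violation A i y \<or> violation A y j"
      using y v \<open>i \<le> y\<close> \<open>y \<le> j\<close>
      by (cases "y = i"; cases "y = j") (auto simp: violation_def unerased_def)
    ultimately show "y \<in> ?R \<union> ?L" by auto
  qed
  then have "real (card (unerased A \<inter> {i..<i + l})) \<le> real (card (?R \<union> ?L))"
    by (simp add: card_mono)
  also have "\<dots> \<le> real (card ?R) + real (card ?L)"
    using card_Un_le[of ?R ?L] by linarith
  finally have "\<delta> * real l \<le> 2 * real (card ?R) \<or> \<delta> * real l \<le> 2 * real (card ?L)"
    by linarith
  moreover have "l \<le> length A" using l by simp
  ultimately show ?thesis using ij l by (auto simp: exposed_def)
qed auto

text \<open>Some completion can be made monotone by changing only sparse and exposed positions, so
  together these number at least \<open>\<epsilon> n\<close>. At density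
  \<open>\<epsilon> / 2\<close> the sparse ones account for at most half of that.\<close>

lemma card_exposed:
  assumes "\<forall>B. completion A B \<longrightarrow> real (dist_to_monotone B) \<ge> \<epsilon> * real (length A)"
    and "0 < \<epsilon>"
  shows "real (card (exposed (\<epsilon> / 2) A)) \<ge> \<epsilon> / 2 * real (length A)"
proof -
  let ?S = "sparse_points (\<epsilon> / 2) (length A) (unerased A)" and ?V = "exposed (\<epsilon> / 2) A"
  have "finite ?S" by (auto simp: sparse_points_def)
  then obtain B where B: "completion A B" "dist_to_monotone B \<le> card (?S \<union> ?V)"
    using completion_near_monotone[of A "?S \<union> ?V"] violation_cover[of A _ _ "\<epsilon> / 2"] by auto
  have "\<epsilon> * real (length A) \<le> real (card (?S \<union> ?V))"
    using assms(1) B by (meson of_nat_le_iff order_trans)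
  also have "\<dots> \<le> real (card ?S) + real (card ?V)"
    using card_Un_le[of ?S ?V] by linarith
  also have "real (card ?S) \<le> \<epsilon> / 2 * real (length A)"
    using assms(2) by (intro card_sparse_points) (auto simp: unerased_def)
  finally show ?thesis by linarith
qed

section \<open>Dyadic scales and the success probability of one trial\<close>

lemma dyadic_scale:
  assumes "0 < l" "l \<le> 2 ^ K"
  shows "\<exists>k\<le>K. l \<le> 2 ^ k \<and> 2 ^ k \<le> 2 * (l::nat)"
proof -
  define k where "k = (LEAST k. l \<le> 2 ^ k)"
  have "l \<le> 2 ^ k" unfolding k_def using assms(2) by (rule LeastI)
  moreover have "k \<le> K" unfolding k_def using assms(2) by (rule Least_le)
  moreover have "2 ^ k \<le> 2 * l"
  proof (cases k)
    case (Suc k')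
    then have "\<not> l \<le> 2 ^ k'" using not_less_Least[of k' "\<lambda>k. l \<le> 2 ^ k"] by (simp add: k_def)
    then show ?thesis using Suc by simp
  qed (use assms in simp)
  ultimately show ?thesis by blast
qed

text \<open>Each residue \<open>d\<close> has the \<open>2 ^ (K - k)\<close> preimages
  \<open>q * 2 ^ k + d\<close>, so a uniform coin below \<open>2 ^ K\<close> can serve as a random
  offset at every scale \<open>k\<close>.\<close>

lemma card_mod_preimage:
  assumes "k \<le> K" "D \<subseteq> {..<2 ^ k}"
  shows "2 ^ (K - k) * card D \<le> card {u \<in> {..<(2::nat) ^ K}. u mod 2 ^ k \<in> D}"
proof -
  let ?f = "\<lambda>(q, d). q * 2 ^ k + d :: nat"
  have inj: "inj_on ?f ({..<2 ^ (K - k)} \<times> D)"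
  proof (rule inj_on_inverseI[where g = "\<lambda>u. (u div 2 ^ k, u mod 2 ^ k)"])
    fix p assume "p \<in> {..<2 ^ (K - k) :: nat} \<times> D"
    then obtain q d where "p = (q, d)" "d < 2 ^ k" using assms(2) by auto
    then show "(?f p div 2 ^ k, ?f p mod 2 ^ k) = p" by simp
  qed
  have "?f ` ({..<2 ^ (K - k)} \<times> D) \<subseteq> {u \<in> {..<2 ^ K}. u mod 2 ^ k \<in> D}"
  proof safe
    fix q d assume q: "q < (2::nat) ^ (K - k)" and d: "d \<in> D"
    then have dk: "d < 2 ^ k" using assms(2) by auto
    have "q * 2 ^ k + d < Suc q * 2 ^ k" using dk by simp
    also have "\<dots> \<le> 2 ^ (K - k) * 2 ^ k" using q by (intro mult_right_mono) auto
    also have "\<dots> = (2::nat) ^ K" using assms(1) by (simp flip: power_add)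
    finally show "q * 2 ^ k + d < 2 ^ K" .
    show "(q * 2 ^ k + d) mod 2 ^ k \<in> D" using dk d by simp
  qed
  from card_inj_on_le[OF inj this] show ?thesis by (simp add: card_cartesian_product)
qed

text \<open>Offsets that leave the array are clipped to its ends, so that every query is legal.
  All scales share the coin range \<open>{..<2 ^ K}\<close>, so that the trials are uniformly distributed.\<close>

definition probes :: "nat \<Rightarrow> nat \<times> nat \<times> nat \<Rightarrow> nat list" where
  "probes n = (\<lambda>(x, k, u). [x, min (x + u mod 2 ^ k) (n - 1), x - u mod 2 ^ k])"

definition trials :: "nat \<Rightarrow> nat \<Rightarrow> (nat \<times> nat \<times> nat) set" where
  "trials n K = {..<n} \<times> {..K} \<times> {..<2 ^ K}"

definition violated_on :: "real option list \<Rightarrow> nat set \<Rightarrow> bool" where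
  "violated_on A Q \<longleftrightarrow> (\<exists>i\<in>Q. \<exists>j\<in>Q. violation A i j)"

text \<open>Rounding the interval length \<open>l\<close> up to a power of two at most doubles it,
  so a fraction \<open>\<delta> / 2\<close> of good offsets becomes at least
  \<open>\<delta> / 4\<close>.\<close>

lemma exposed_trials:
  assumes x: "x \<in> exposed \<delta> A" and K: "length A \<le> 2 ^ K"
  shows "\<exists>k\<le>K. \<delta> / 4 * 2 ^ K \<le>
    real (card {u \<in> {..<2 ^ K}. violated_on A (set (probes (length A) (x, k, u)))})"
proof -
  obtain l where l: "0 < l" "l \<le> length A"
    and c: "\<delta> * real l \<le> 2 * real (card {y. violation A x y \<and> y < x + l}) \<or>
            \<delta> * real l \<le> 2 * real (card {y. violation A y x \<and> x < y + l})"
    using x by (auto simp: exposed_def)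
  obtain k where k: "k \<le> K" "l \<le> 2 ^ k" "2 ^ k \<le> 2 * l"
    using dyadic_scale[of l K] l K by auto
  \<comment> \<open>Offsets leading to a partner on either side, since a trial probes both. The
    guard \<open>d \<le> x\<close> excludes offsets that truncated subtraction would send to
    0.\<close>
  define D where "D = {d. d < 2 ^ k \<and> (violation A x (x + d) \<or> d \<le> x \<and> violation A (x - d) x)}"
  have D: "D \<subseteq> {..<2 ^ k}" by (auto simp: D_def)
  then have finD: "finite D" using finite_subset by blast
  have "card {y. violation A x y \<and> y < x + l} \<le> card D"
    by (rule card_inj_on_le[OF _ _ finD, of "\<lambda>y. y - x"])
       (use k in \<open>auto simp: inj_on_def D_def violation_def\<close>)
  moreover have "card {y. violation A y x \<and> x < y + l} \<le> card D"
    by (rule card_inj_on_le[OF _ _ finD, of "\<lambda>y. x - y"])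
       (use k in \<open>auto simp: inj_on_def D_def violation_def\<close>)
  ultimately have cD: "\<delta> * real l \<le> 2 * real (card D)" using c by linarith
  have "\<delta> * 2 ^ k \<le> 4 * real (card D)"
  proof (cases "0 \<le> \<delta>")
    case True
    have "(2::real) ^ k \<le> 2 * real l"
      using k(3) by (metis of_nat_le_iff of_nat_mult of_nat_numeral of_nat_power)
    then have "\<delta> * 2 ^ k \<le> \<delta> * (2 * real l)" using True by (rule mult_left_mono)
    with cD show ?thesis by linarith
  next
    case False
    then have "\<delta> * 2 ^ k \<le> 0" by (simp add: mult_nonpos_nonneg)
    then show ?thesis by (rule order_trans) simp
  qed
  then have "\<delta> * 2 ^ k * 2 ^ (K - k) \<le> 4 * real (card D) * 2 ^ (K - k)"
    by (rule mult_right_mono) simp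
  moreover have "(2::real) ^ k * 2 ^ (K - k) = 2 ^ K" using k(1) by (simp flip: power_add)
  ultimately have "\<delta> / 4 * 2 ^ K \<le> real (2 ^ (K - k) * card D)"
    by (simp add: mult_ac)
  also have "\<dots> \<le> real (card {u \<in> {..<2 ^ K}. u mod 2 ^ k \<in> D})"
    using card_mod_preimage[OF k(1) D] by (simp only: of_nat_le_iff)
  also have "\<dots> \<le> real (card {u \<in> {..<2 ^ K}. violated_on A (set (probes (length A) (x, k, u)))})"
  proof (intro of_nat_mono card_mono Collect_mono impI conjI; (elim conjE)?)
    fix u assume "u mod 2 ^ k \<in> D"
    then consider "violation A x (x + u mod 2 ^ k)" | "violation A (x - u mod 2 ^ k) x"
      by (auto simp: D_def)
    then show "violated_on A (set (probes (length A) (x, k, u)))"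
    proof cases
      case 1
      \<comment> \<open>The partner lies inside the array, so clipping does not move it.\<close>
      then have "min (x + u mod 2 ^ k) (length A - 1) = x + u mod 2 ^ k"
        by (auto simp: violation_def)
      with 1 show ?thesis by (simp add: violated_on_def probes_def)
    qed (simp add: violated_on_def probes_def)
  qed auto
  finally show ?thesis using k(1) by blast
qed

text \<open>The bound is a product of three fractions: \<open>\<epsilon> / 2\<close> for an exposed
  position \<open>x\<close>, \<open>1 / (K + 1)\<close> for the one scale \<open>s x\<close> that is
  good for it, and \<open>\<epsilon> / 8\<close> for a good coin at that scale.\<close>

lemma card_violated_trials:
  assumes far: "\<forall>B. completion A B \<longrightarrow> real (dist_to_monotone B) \<ge> \<epsilon> * real (length A)"
    and eps: "0 < \<epsilon>" and K: "length A \<le> 2 ^ K"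
  shows "\<epsilon>\<^sup>2 / (16 * real (K + 1)) * real (card (trials (length A) K)) \<le>
    real (card {t \<in> trials (length A) K. violated_on A (set (probes (length A) t))})"
proof -
  let ?n = "length A" and ?V = "exposed (\<epsilon> / 2) A"
  define U where "U x k = {u \<in> {..<2 ^ K}. violated_on A (set (probes (length A) (x, k, u)))}" for x k
  obtain s where s: "\<And>x. x \<in> ?V \<Longrightarrow> s x \<le> K \<and> \<epsilon> / 2 / 4 * 2 ^ K \<le> real (card (U x (s x)))"
  proof -
    have "\<forall>x\<in>?V. \<exists>k. k \<le> K \<and> \<epsilon> / 2 / 4 * 2 ^ K \<le> real (card (U x k))"
      using exposed_trials[OF _ K] unfolding U_def by blast
    from bchoice[OF this] show thesis using that by blast
  qed
  have "real (card (trials ?n K)) = real ?n * (real (K + 1) * 2 ^ K)"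
    by (simp add: trials_def card_cartesian_product algebra_simps)
  then have "\<epsilon>\<^sup>2 / (16 * real (K + 1)) * real (card (trials ?n K)) = (\<epsilon> / 2 * real ?n) * (\<epsilon> / 2 / 4 * 2 ^ K)"
    by (simp add: power2_eq_square del: of_nat_Suc of_nat_add)
  also have "\<dots> \<le> real (card ?V) * (\<epsilon> / 2 / 4 * 2 ^ K)"
    using eps by (intro mult_right_mono card_exposed[OF far eps]) auto
  also have "\<dots> \<le> (\<Sum>x\<in>?V. real (card (U x (s x))))"
    using s sum_bounded_below[of ?V "\<epsilon> / 2 / 4 * 2 ^ K" "\<lambda>x. real (card (U x (s x)))"] by simp
  also have "\<dots> = real (card (SIGMA x:?V. {s x} \<times> U x (s x)))"
    by (subst card_SigmaI) (auto simp: U_def card_cartesian_product)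
  also have "\<dots> \<le> real (card {t \<in> trials ?n K. violated_on A (set (probes ?n t))})"
  proof (intro of_nat_mono card_mono)
    show "finite {t \<in> trials ?n K. violated_on A (set (probes ?n t))}"
      by (simp add: trials_def)
    show "(SIGMA x:?V. {s x} \<times> U x (s x)) \<subseteq> {t \<in> trials ?n K. violated_on A (set (probes ?n t))}"
      using s by (auto simp: U_def trials_def exposed_def)
  qed
  finally show ?thesis .
qed

section \<open>Nonadaptive decision trees that search for violations\<close>

text \<open>The answers only accumulate in the argument of \<open>d\<close>, so they influence the
  verdict but never the next query.\<close>

primrec ask :: "nat list \<Rightarrow> (real option list \<Rightarrow> bool) \<Rightarrow> query_algorithm" where
  "ask [] d = Decide (d [])"
| "ask (q # qs) d = Query q (\<lambda>a. ask qs (\<lambda>as. d (a # as)))"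

lemma queries_ask [simp]: "queries (ask qs d) A = qs"
  by (induction qs arbitrary: d) auto

lemma accepts_ask [simp]: "accepts (ask qs d) A = d (map ((!) A) qs)"
  by (induction qs arbitrary: d) auto

definition violation_search :: "nat list \<Rightarrow> query_algorithm" where
  "violation_search qs = ask qs (\<lambda>as. \<forall>(i, a)\<in>set (zip qs as). \<forall>(j, b)\<in>set (zip qs as).
     i < j \<longrightarrow> a \<noteq> None \<longrightarrow> b \<noteq> None \<longrightarrow> the a \<le> the b)"

lemma queries_violation_search [simp]: "queries (violation_search qs) A = qs"
  by (simp add: violation_search_def)

lemma accepts_violation_search:
  assumes "set qs \<subseteq> {..<length A}"
  shows "accepts (violation_search qs) A \<longleftrightarrow> \<not> violated_on A (set qs)"
proof -
  have "set (zip qs (map ((!) A) qs)) = (\<lambda>q. (q, A ! q)) ` set qs"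
    by (induction qs) auto
  moreover have "violation A i j \<longleftrightarrow>
      \<not> (i < j \<longrightarrow> A ! i \<noteq> None \<longrightarrow> A ! j \<noteq> None \<longrightarrow> the (A ! i) \<le> the (A ! j))"
    if "j \<in> set qs" for i j
    using that assms by (auto simp: violation_def)
  ultimately show ?thesis
    by (simp add: violation_search_def violated_on_def del: not_None_eq) blast
qed

lemma set_probes:
  "t \<in> trials n K \<Longrightarrow> set (probes n t) \<subseteq> {..<n}"
  by (auto simp: probes_def trials_def)

section \<open>Independent repetition and its error probability\<close>

text \<open>A uniformly random list of \<open>m\<close> trials amounts to \<open>m\<close>
  independent uniform trials, which reduces probabilities to counting lists.\<close>

definition repeated_trials :: "nat \<Rightarrow> nat \<Rightarrow> nat \<Rightarrow> randomized_algorithm" where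
  "repeated_trials n K m =
     map_pmf (\<lambda>ts. violation_search (concat (map (probes n) ts)))
       (pmf_of_set {ts. set ts \<subseteq> trials n K \<and> length ts = m})"

lemma finite_trials [simp]: "finite (trials n K)"
  by (simp add: trials_def)

lemma finite_trial_lists [simp]: "finite {ts. set ts \<subseteq> trials n K \<and> length ts = m}"
  by (simp add: finite_lists_length_eq)

lemma trial_lists_nonempty:
  assumes "0 < n"
  shows "{ts. set ts \<subseteq> trials n K \<and> length ts = m} \<noteq> {}"
proof -
  have "replicate m (0, 0, 0) \<in> {ts. set ts \<subseteq> trials n K \<and> length ts = m}"
    using assms by (auto simp: trials_def)
  then show ?thesis by blast
qed

lemma set_pmf_repeated_trials:
  assumes "0 < n"
  shows "set_pmf (repeated_trials n K m) =
    (\<lambda>ts. violation_search (concat (map (probes n) ts))) ` {ts. set ts \<subseteq> trials n K \<and> length ts = m}"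
  using trial_lists_nonempty[OF assms] by (simp add: repeated_trials_def)

lemma probe_lists_in_range:
  "set ts \<subseteq> trials n K \<Longrightarrow> set (concat (map (probes n) ts)) \<subseteq> {..<n}"
  using set_probes by fastforce

text \<open>The error is one-sided: with a sorted completion there is no violation to be
  found.\<close>

lemma repeated_trials_complete:
  assumes "0 < length A" "completion A B" "sorted B"
  shows "measure_pmf.prob (repeated_trials (length A) K m) {t. accepts t A} = 1"
proof -
  have "AE t in measure_pmf (repeated_trials (length A) K m). accepts t A"
    unfolding AE_measure_pmf_iff set_pmf_repeated_trials[OF assms(1)]
    using probe_lists_in_range sorted_completion_no_violation[OF assms(2,3)]
    by (auto simp: accepts_violation_search violated_on_def)
  then show ?thesis by (simp add: measure_pmf.prob_eq_1)
qed

text \<open>Acceptance forces all \<open>m\<close> trials to miss \<open>W\<close>, which has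
  probability at most \<open>(1 - p) ^ m \<le> exp (- p * m)\<close>.\<close>

lemma prob_accept_repeated_trials:
  assumes n: "0 < length A"
    and far: "\<forall>B. completion A B \<longrightarrow> real (dist_to_monotone B) \<ge> \<epsilon> * real (length A)"
    and eps: "0 < \<epsilon>" and K: "length A \<le> 2 ^ K"
  shows "measure_pmf.prob (repeated_trials (length A) K m) {t. accepts t A} \<le>
    exp (- (\<epsilon>\<^sup>2 / (16 * real (K + 1))) * real m)"
proof -
  let ?n = "length A"
  let ?S = "trials ?n K"
  define W where "W = {t \<in> ?S. violated_on A (set (probes ?n t))}"
  define p where "p = \<epsilon>\<^sup>2 / (16 * real (K + 1))"
  have S: "card ?S > 0" using n by (simp add: trials_def card_cartesian_product)
  have W: "W \<subseteq> ?S" "p * real (card ?S) \<le> real (card W)"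
    using card_violated_trials[OF far eps K] by (auto simp: W_def p_def)
  let ?L = "{ts. set ts \<subseteq> ?S \<and> length ts = m}"
  have "measure_pmf.prob (repeated_trials ?n K m) {t. accepts t A} =
      real (card (?L \<inter> {ts. accepts (violation_search (concat (map (probes ?n) ts))) A})) / real (card ?L)"
    using trial_lists_nonempty[OF n]
    by (simp add: repeated_trials_def measure_pmf_of_set vimage_def)
  also have "\<dots> \<le> real (card {ts. set ts \<subseteq> ?S - W \<and> length ts = m}) / real (card ?L)"
  proof (intro divide_right_mono of_nat_mono card_mono)
    \<comment> \<open>The search also compares probes of different trials, which can only cause more
      rejections; hence an inclusion.\<close>
    show "?L \<inter> {ts. accepts (violation_search (concat (map (probes ?n) ts))) A} \<subseteq>
        {ts. set ts \<subseteq> ?S - W \<and> length ts = m}"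
      using accepts_violation_search[OF probe_lists_in_range]
      by (fastforce simp: W_def violated_on_def)
  qed (simp_all add: finite_lists_length_eq)
  also have "\<dots> = (real (card (?S - W)) / real (card ?S)) ^ m"
    by (simp add: card_lists_length_eq power_divide)
  also have "real (card (?S - W)) = real (card ?S) - real (card W)"
    using W(1) by (simp add: card_Diff_subset finite_subset card_mono of_nat_diff)
  also have "((real (card ?S) - real (card W)) / real (card ?S)) ^ m \<le> exp (- p) ^ m"
  proof (rule power_mono)
    have "(real (card ?S) - real (card W)) / real (card ?S) \<le> 1 - p"
      using W(2) S
      by (simp add: pos_divide_le_eq left_diff_distrib del: card_gt_0_iff diff_divide_distrib)
    also have "\<dots> \<le> exp (- p)" using exp_ge_add_one_self[of "- p"] by simp
    finally show "(real (card ?S) - real (card W)) / real (card ?S) \<le> exp (- p)" .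
    show "0 \<le> (real (card ?S) - real (card W)) / real (card ?S)"
      using W(1) by (simp add: card_mono)
  qed
  also have "exp (- p) ^ m = exp (- p * real m)"
    by (simp flip: exp_of_nat_mult add: mult.commute)
  finally show ?thesis by (simp add: p_def)
qed

lemma repeated_trials_tester:
  assumes n: "2 \<le> n" and eps: "0 < \<epsilon>" and K: "n \<le> 2 ^ K"
    and m: "32 * real (K + 1) / \<epsilon>\<^sup>2 \<le> real m"
  shows "erasure_resilient_tester \<alpha> \<epsilon> n (repeated_trials n K m)"
  unfolding erasure_resilient_tester_def
proof (intro conjI allI impI; (elim conjE exE)?)
  show "legal_queries n (repeated_trials n K m)"
    unfolding legal_queries_def using n
    by (auto simp: set_pmf_repeated_trials simp del: set_concat
        dest!: probe_lists_in_range dest: subsetD)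
next
  fix A B assume "length A = n" "completion A B" "sorted B"
  then show "2 / 3 \<le> measure_pmf.prob (repeated_trials n K m) {t. accepts t A}"
    using repeated_trials_complete[of A B K m] n by auto
next
  fix A :: "real option list"
  assume A: "length A = n" and
    far: "\<forall>B. completion A B \<longrightarrow> \<epsilon> * real n \<le> real (dist_to_monotone B)"
  let ?T = "repeated_trials n K m"
  have "measure_pmf.prob ?T {t. accepts t A} \<le> exp (- (\<epsilon>\<^sup>2 / (16 * real (K + 1))) * real m)"
    using prob_accept_repeated_trials[of A \<epsilon> K m] A far n eps K by auto
  \<comment> \<open>The constant 32 in the bound on \<open>m\<close> is twice the 16 of the success
    probability, which makes the exponent at most -2.\<close>
  also have "\<dots> \<le> exp (- 2)"
    using m eps by (simp add: field_simps)
  also have "\<dots> \<le> (1 / 3 :: real)"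
    using exp_ge_add_one_self[of "2::real"] by (simp add: exp_minus field_simps)
  finally have "measure_pmf.prob ?T {t. accepts t A} \<le> 1 / 3" .
  moreover have "{t. \<not> accepts t A} = UNIV - {t. accepts t A}" by auto
  then have "measure_pmf.prob ?T {t. \<not> accepts t A} = 1 - measure_pmf.prob ?T {t. accepts t A}"
    using measure_pmf.prob_compl[of "{t. accepts t A}" ?T] by simp
  ultimately show "2 / 3 \<le> measure_pmf.prob ?T {t. \<not> accepts t A}" by linarith
qed

lemma nonadaptive_repeated_trials:
  "0 < n \<Longrightarrow> nonadaptive n (repeated_trials n K m)"
  by (auto simp: nonadaptive_def set_pmf_repeated_trials)

lemma length_probe_lists: "length (concat (map (probes n) ts)) = 3 * length ts"
  by (induction ts) (auto simp: probes_def split: prod.splits)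

lemma queries_repeated_trials:
  assumes "0 < n" "real (3 * m) \<le> q"
  shows "makes_at_most_queries n (repeated_trials n K m) q"
  using assms length_probe_lists
  by (auto simp: makes_at_most_queries_def set_pmf_repeated_trials)

section \<open>Choice of the parameters and the query count\<close>

theorem theorem1p3:
  "\<exists>C::real. \<forall>(\<epsilon>::real) (\<alpha>::real) (n::nat).
     0 < \<epsilon> \<and> \<epsilon> < 1 \<and> 0 < \<alpha> \<and> \<alpha> < 1 \<and> \<alpha> + \<epsilon> < 1 \<and> 2 \<le> n \<longrightarrow>
     (\<exists>T. erasure_resilient_tester \<alpha> \<epsilon> n T \<and> nonadaptive n T \<and>
          makes_at_most_queries n T (C * (log 2 (real n) / \<epsilon> ^ 2 + 1 / \<epsilon> ^ 3)))"
proof (intro exI[of _ 300] allI impI; elim conjE)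
  fix \<epsilon> \<alpha> :: real and n :: nat
  assume eps: "0 < \<epsilon>" "\<epsilon> < 1" and n: "2 \<le> n"
  define lg where "lg = log 2 (real n)"
  define K where "K = nat \<lceil>lg\<rceil>"
  define m where "m = nat \<lceil>32 * real (K + 1) / \<epsilon>\<^sup>2\<rceil>"
  have lg: "1 \<le> lg" using n by (simp add: lg_def)
  have "lg \<le> real K" unfolding K_def by linarith
  then have "2 powr lg \<le> 2 powr real K" by simp
  then have "real n \<le> real (2 ^ K)" using n by (simp add: lg_def powr_realpow)
  then have K: "n \<le> 2 ^ K" by (simp only: of_nat_le_iff)
  have "real K \<le> lg + 1" unfolding K_def using lg by linarith
  then have K3: "real (K + 1) \<le> 3 * lg" using lg by simp
  have m: "32 * real (K + 1) / \<epsilon>\<^sup>2 \<le> real m" unfolding m_def by linarith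
  have "0 \<le> 32 * real (K + 1) / \<epsilon>\<^sup>2" by simp
  then have "real m \<le> 32 * real (K + 1) / \<epsilon>\<^sup>2 + 1" unfolding m_def by linarith
  \<comment> \<open>The 1 lost by rounding \<open>m\<close> up is absorbed by
    \<open>lg / \<epsilon>\<^sup>2\<close>, giving
    \<open>m \<le> 97 * lg / \<epsilon>\<^sup>2\<close>; three probes per trial yield 291, which 300
    rounds up.\<close>
  also have "\<dots> \<le> 32 * (3 * lg) / \<epsilon>\<^sup>2 + lg / \<epsilon>\<^sup>2"
  proof (intro add_mono divide_right_mono mult_left_mono K3)
    have "\<epsilon>\<^sup>2 \<le> 1" using eps by (simp add: power_le_one)
    then show "1 \<le> lg / \<epsilon>\<^sup>2" using eps lg by (simp add: field_simps)
  qed auto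
  finally have "real (3 * m) \<le> 291 * (lg / \<epsilon>\<^sup>2)" by simp
  also have "\<dots> \<le> 300 * (lg / \<epsilon>\<^sup>2 + 1 / \<epsilon> ^ 3)"
  proof -
    have "291 * a \<le> 300 * (a + b)" if "0 \<le> a" "0 \<le> b" for a b :: real using that by simp
    moreover have "0 \<le> lg / \<epsilon>\<^sup>2" "0 \<le> 1 / \<epsilon> ^ 3" using eps lg by simp_all
    ultimately show ?thesis by blast
  qed
  finally have "real (3 * m) \<le> 300 * (lg / \<epsilon>\<^sup>2 + 1 / \<epsilon> ^ 3)" .
  then show "\<exists>T. erasure_resilient_tester \<alpha> \<epsilon> n T \<and> nonadaptive n T \<and>
      makes_at_most_queries n T (300 * (log 2 (real n) / \<epsilon> ^ 2 + 1 / \<epsilon> ^ 3))"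
    using repeated_trials_tester[OF n eps(1) K m] nonadaptive_repeated_trials
      queries_repeated_trials n
    by (intro exI[of _ "repeated_trials n K m"]) (auto simp: lg_def)
qed

end
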